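(* Let $A(x)=K_0(x)\,\mathbf{L}_{-1}(x)+K_1(x)\,\mathbf{L}_0(x)$ for real $x>0$, and let $$\mathbb{M}=\langle 1,K_0,K_1,A\rangle_{\mathbb{R}[x]}=\operatorname{Span}_{\mathbb{R}[x]}(\{1,K_0,K_1,A\})$$ be the $\mathbb{R}[x]$-module of functions on $(0,\infty)$ generated by $1,K_0,K_1,A$. Then $$\{Ki_n \mid n\ge 0\}\subset \mathbb{M};$$ that is, for every integer $n\ge 0$ the Bickley-Naylor function $Ki_n$ is a linear combination of $1,K_0,K_1,A$ with coefficients that are real polynomials in $x$.
   Context: For an integer $n\ge 0$ and real $x>0$, the Bickley-Naylor function of order $n$ is $$Ki_n(x)=\int_0^{\pi/2} e^{-x\sec\theta}\cos^{n-1}\theta\,d\theta=\int_0^\infty e^{-x\cosh t}\cosh^{-n}t\,dt .$$ For $x>0$, $K_\nu(x)=\int_0^\infty e^{-x\cosh t}\cosh(\nu t)\,dt$ is the modified Bessel function of the second kind, and $$\mathbf{L}_\nu(x)=\sum_{m=0}^\infty \frac{(x/2)^{2m+\nu+1}}{\Gamma(m+\frac32)\,\Gamma(m+\nu+\frac32)}$$ is the modified Struve function of order $\nu$ (used here for $\nu=0$ and $\nu=-1$). All functions are regarded as real-valued functions on $(0,\infty)$, and $\mathbb{R}[x]$ acts on such functions by pointwise multiplication; $1$ denotes the constant function. The span over $\mathbb{R}[x]$ of a finite set of functions is the set of all their combinations with coefficients in $\mathbb{R}[x]$. *)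

theory Defs
  imports
    "HOL-Analysis.Analysis"
    "HOL-Library.Function_Algebras"
    "HOL-Computational_Algebra.Polynomial"
begin

definition bickley_naylor :: "nat \<Rightarrow> real \<Rightarrow> real" where
  "bickley_naylor n x = (LBINT \<theta>=0..pi/2. exp (- x / cos \<theta>) * cos \<theta> powi (int n - 1))"

definition bessel_K :: "real \<Rightarrow> real \<Rightarrow> real" where
  "bessel_K \<nu> x = (LBINT t=0..\<infinity>. exp (- x * cosh t) * cosh (\<nu> * t))"

definition struve_L :: "real \<Rightarrow> real \<Rightarrow> real" where
  "struve_L \<nu> x =
     (\<Sum>m. (x / 2) powr (2 * real m + \<nu> + 1) / (Gamma (real m + 3/2) * Gamma (real m + \<nu> + 3/2)))"

definition A_fun :: "real \<Rightarrow> real" where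
  "A_fun x = bessel_K 0 x * struve_L (-1) x + bessel_K 1 x * struve_L 0 x"

text \<open>
  A real function on \<open>(0,\<infinity>)\<close> is represented by the total function that extends it by 0.
  These extensions form a submodule of all functions \<open>real \<Rightarrow> real\<close>, isomorphic to the
  functions on \<open>(0,\<infinity>)\<close>; values at nonpositive arguments thus carry no information.
\<close>
definition on_pos :: "(real \<Rightarrow> real) \<Rightarrow> real \<Rightarrow> real" where
  "on_pos f = (\<lambda>x. if x > 0 then f x else 0)"

definition poly_scale :: "real poly \<Rightarrow> (real \<Rightarrow> real) \<Rightarrow> real \<Rightarrow> real" where
  "poly_scale p f = (\<lambda>x. poly p x * f x)"

interpretation poly_fun: module poly_scale
  by unfold_locales (auto simp: poly_scale_def algebra_simps)

definition M_module :: "(real \<Rightarrow> real) set" where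
  "M_module = poly_fun.span (on_pos ` {\<lambda>_. 1, bessel_K 0, bessel_K 1, A_fun})"

lemma cos_arctan_sinh: "cos (arctan (sinh t)) = 1 / cosh (t::real)"
proof -
  have "1 + (sinh t)\<^sup>2 = (cosh t)\<^sup>2"
    by (simp add: cosh_square_eq)
  then show ?thesis
    by (simp add: cos_arctan)
qed

lemma bickley_naylor_integrable:
  fixes x :: real
  assumes "x > 0"
  shows "set_integrable lborel {0<..} (\<lambda>t. exp (- x * cosh t) / cosh t ^ n)"
proof -
  have *: "set_integrable lborel {0<..} (\<lambda>t::real. exp (- x * t))"
  proof -
    have "(\<lambda>t. exp (- x * t)) absolutely_integrable_on {0..}"
      using integrable_on_exp_minus_to_infinity[OF assms, of 0]
      by (intro nonnegative_absolutely_integrable_1) auto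
    then have "(\<lambda>t. exp (- x * t)) absolutely_integrable_on {0<..}"
      by (rule set_integrable_subset) auto
    then show ?thesis
      unfolding set_integrable_def by (subst (asm) integrable_completion) auto
  qed
  have bound: "norm (exp (- x * cosh t) / cosh t ^ n) \<le> norm (exp (- x * t))" if "t > 0" for t
  proof -
    have "2 * t \<le> 1 + t + t\<^sup>2 / 2"
      using zero_le_power2[of "t - 1"] by (simp add: power2_eq_square algebra_simps)
    also have "\<dots> \<le> exp t"
      using that by (intro exp_lower_Taylor_quadratic) auto
    also have "\<dots> \<le> exp t + exp (- t)"
      by simp
    finally have "t \<le> cosh t"
      unfolding cosh_field_def by simp
    then have "exp (- x * cosh t) \<le> exp (- x * t)"
      using assms by simp
    moreover have "1 \<le> cosh t ^ n"
      by (simp add: cosh_real_ge_1)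
    ultimately have "exp (- x * cosh t) / cosh t ^ n \<le> exp (- x * t) / 1"
      by (intro frac_le) auto
    then show ?thesis
      by simp
  qed
  show ?thesis
  proof (rule set_integrable_bound[OF *])
    show "set_borel_measurable lborel {0<..} (\<lambda>t. exp (- x * cosh t) / cosh t ^ n)"
      unfolding set_borel_measurable_def
      by (intro borel_measurable_scaleR borel_measurable_indicator)
        (auto intro!: borel_measurable_continuous_onI continuous_intros)
    show "AE t in lborel. t \<in> {0<..} \<longrightarrow>
        norm (exp (- x * cosh t) / cosh t ^ n) \<le> norm (exp (- x * t))"
      using bound by (intro AE_I2) auto
  qed
qed

text \<open>
  The two usual integral representations agree; the substitution is \<open>\<theta> = arctan (sinh t)\<close>.
\<close>
lemma bickley_naylor_cosh:
  fixes x :: real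
  assumes "x > 0"
  shows "bickley_naylor n x = (LBINT t=0..\<infinity>. exp (- x * cosh t) / cosh t ^ n)"
proof -
  define f where "f = (\<lambda>\<theta>. exp (- x / cos \<theta>) * cos \<theta> powi (int n - 1))"
  define g where "g = (\<lambda>t::real. arctan (sinh t))"
  have eq: "f (g t) * (1 / cosh t) = exp (- x * cosh t) / cosh t ^ n" for t
    by (simp add: f_def g_def cos_arctan_sinh power_int_diff power_int_divide_distrib field_simps)
  have cg: "cos (g t) = 1 / cosh t" for t
    by (simp add: g_def cos_arctan_sinh)
  have e0: "einterval 0 \<infinity> = {0<..}"
    by (auto simp: einterval_def)
  have "(LBINT \<theta>=0..ereal (pi/2). f \<theta>) = (LBINT t=0..\<infinity>. f (g t) * (1 / cosh t))"
  proof (rule interval_integral_substitution_nonneg(2))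
    fix t :: real
    have "(cosh t)\<^sup>2 = 1 + (sinh t)\<^sup>2"
      by (simp add: cosh_square_eq)
    then show "DERIV g t :> 1 / cosh t"
      unfolding g_def
      by (auto intro!: derivative_eq_intros simp: power2_eq_square field_simps)
    show "isCont f (g t)"
      unfolding f_def by (intro continuous_intros) (auto simp: cg)
    show "isCont (\<lambda>t. 1 / cosh t) t"
      by (intro continuous_intros) auto
    show "0 \<le> f (g t)"
      unfolding f_def by (intro mult_nonneg_nonneg zero_le_power_int) (auto simp: cg)
  next
    have "isCont g 0"
      unfolding g_def by (intro continuous_intros)
    then have "(g \<longlongrightarrow> 0) (at_right 0)"
      by (simp add: isCont_def g_def filterlim_at_split)
    then show "((ereal \<circ> g \<circ> real_of_ereal) \<longlongrightarrow> 0) (at_right 0)"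
      unfolding zero_ereal_def ereal_tendsto_simps .
  next
    have "(g \<longlongrightarrow> pi / 2) at_top"
      unfolding g_def by (rule filterlim_compose[OF tendsto_arctan_at_top sinh_real_at_top])
    then show "((ereal \<circ> g \<circ> real_of_ereal) \<longlongrightarrow> ereal (pi / 2)) (at_left \<infinity>)"
      unfolding ereal_tendsto_simps .
  next
    show "set_integrable lborel (einterval 0 \<infinity>) (\<lambda>t. f (g t) * (1 / cosh t))"
      unfolding eq e0 by (rule bickley_naylor_integrable[OF assms])
  qed auto
  then show ?thesis
    unfolding bickley_naylor_def eq by (simp add: f_def)
qed

end

theory Submission
  imports Defs
begin

text \<open>
  Integration by parts gives \<open>n Ki\<^sub>n\<^sub>+\<^sub>1 = x Ki\<^sub>n\<^sub>-\<^sub>2 - x Ki\<^sub>n + (n - 1) Ki\<^sub>n\<^sub>-\<^sub>1\<close> for \<open>n \<ge> 1\<close>,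
  where \<open>Ki\<^sub>-\<^sub>1 = K\<^sub>1\<close>, so everything reduces to \<open>Ki\<^sub>0 = K\<^sub>0\<close> and \<open>Ki\<^sub>1\<close>. For the latter,
  \<open>(x A)' = 2/\<pi> K\<^sub>0 = - 2/\<pi> Ki\<^sub>1'\<close>, and comparing the limits at \<open>0\<close> yields
  \<open>Ki\<^sub>1 = \<pi>/2 (1 - x A)\<close>.
\<close>

section \<open>Cosh moments\<close>

text \<open>For the integer \<open>k\<close> this is \<open>Ki\<^sub>-\<^sub>k\<close>; in particular \<open>k = 0, 1\<close> give \<open>K\<^sub>0\<close> and \<open>K\<^sub>1\<close>.\<close>

definition cosh_moment :: "int \<Rightarrow> real \<Rightarrow> real" where
  "cosh_moment k x = (LBINT t:{0<..}. exp (- x * cosh t) * cosh t powi k)"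

text \<open>For nonnegative \<open>u\<close> a single term of the exponential series is at most the
  whole sum.\<close>

lemma power_le_fact_exp:
  fixes u :: real
  assumes "u \<ge> 0"
  shows "u ^ n \<le> fact n * exp u"
proof -
  have "u ^ n /\<^sub>R fact n \<le> (\<Sum>i\<in>{n}. u ^ i /\<^sub>R fact i)"
    by simp
  also have "\<dots> \<le> (\<Sum>i. u ^ i /\<^sub>R fact i)"
    using assms by (intro sum_le_suminf summable_exp_generic) auto
  also have "\<dots> = exp u"
    by (simp add: exp_def)
  finally show ?thesis
    by (simp add: field_simps)
qed

lemma power_mult_exp_minus_le_fact:
  fixes u :: real
  assumes "u \<ge> 0"
  shows "u ^ n * exp (- u) \<le> fact n"
  using power_le_fact_exp[OF assms, of n] by (simp add: exp_minus field_simps)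

text \<open>Half of the exponent absorbs the power: with \<open>u = x / 2 * cosh t\<close>, the
  factor \<open>u ^ N * exp (- u)\<close> is at most \<open>fact N\<close>, and rescaling gives
  \<open>(2 / x) ^ N\<close>. Negative \<open>k\<close> is covered because \<open>cosh t\<close> is
  at least 1.\<close>

lemma exp_cosh_times_powi_bound:
  fixes x t :: real
  assumes "x > 0"
  shows "exp (- x * cosh t) * cosh t powi k
    \<le> fact (nat \<bar>k\<bar>) * (2 / x) ^ nat \<bar>k\<bar> * exp (- (x / 2) * cosh t)"
proof -
  let ?N = "nat \<bar>k\<bar>" and ?c = "cosh t"
  have c: "?c \<ge> 1"
    by (rule cosh_real_ge_1)
  have "?c powi k \<le> ?c powi int ?N"
    using c by (intro power_int_increasing) auto
  then have "exp (- x * ?c) * ?c powi k \<le> exp (- x * ?c) * ?c ^ ?N"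
    by (intro mult_left_mono) (auto simp: power_int_def split: if_splits)
  also have "\<dots> = (2 / x) ^ ?N * ((x / 2 * ?c) ^ ?N * exp (- (x / 2 * ?c))) * exp (- (x / 2) * ?c)"
    using assms by (simp add: power_mult_distrib power_divide exp_add[symmetric])
  also have "\<dots> \<le> (2 / x) ^ ?N * fact ?N * exp (- (x / 2) * ?c)"
    using assms by (intro mult_right_mono mult_left_mono power_mult_exp_minus_le_fact) auto
  finally show ?thesis
    by (simp add: mult_ac)
qed

lemma cosh_moment_integrable:
  fixes x :: real
  assumes "x > 0"
  shows "set_integrable lborel {0<..} (\<lambda>t. exp (- x * cosh t) * cosh t powi k)"
proof (rule set_integrable_bound)
  \<comment> \<open>The trivial divisor \<open>cosh t ^ 0\<close> puts the majorant in the form of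
    \<open>bickley_naylor_integrable\<close> with order 0 and argument \<open>x / 2\<close>.\<close>
  show "set_integrable lborel {0<..}
      (\<lambda>t. fact (nat \<bar>k\<bar>) * (2 / x) ^ nat \<bar>k\<bar> * (exp (- (x / 2) * cosh t) / cosh t ^ 0))"
    using bickley_naylor_integrable[of "x / 2" 0] assms by (intro set_integrable_mult_right) auto
  show "set_borel_measurable lborel {0<..} (\<lambda>t. exp (- x * cosh t) * cosh t powi k)"
    unfolding set_borel_measurable_def
    by (intro borel_measurable_scaleR borel_measurable_indicator)
      (auto intro!: borel_measurable_continuous_onI continuous_intros)
  show "AE t in lborel. t \<in> {0<..} \<longrightarrow> norm (exp (- x * cosh t) * cosh t powi k)
      \<le> norm (fact (nat \<bar>k\<bar>) * (2 / x) ^ nat \<bar>k\<bar> * (exp (- (x / 2) * cosh t) / cosh t ^ 0))"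
    using exp_cosh_times_powi_bound[OF assms] assms by (intro AE_I2) (auto simp: abs_mult)
qed

lemma bickley_naylor_eq_cosh_moment:
  "x > 0 \<Longrightarrow> bickley_naylor n x = cosh_moment (- int n) x"
  by (simp add: bickley_naylor_cosh cosh_moment_def interval_lebesgue_integral_0_infty
      power_int_minus divide_inverse)

lemma bessel_K_eq_cosh_moment:
  "bessel_K 0 = cosh_moment 0" "bessel_K 1 = cosh_moment 1"
  by (simp_all add: bessel_K_def cosh_moment_def interval_lebesgue_integral_0_infty fun_eq_iff)

text \<open>Dividing the remainder by \<open>h\<close> leaves an error of at most
  \<open>C * \<bar>h\<bar>\<close>. In this form, differentiation under an integral reduces to
  integrating a pointwise remainder estimate.\<close>

lemma has_field_derivative_quadratic_error:
  fixes f :: "real \<Rightarrow> real"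
  assumes "\<delta> > 0" and err: "\<And>h. \<bar>h\<bar> < \<delta> \<Longrightarrow> \<bar>f (x + h) - f x - h * D\<bar> \<le> C * h\<^sup>2"
  shows "(f has_real_derivative D) (at x)"
proof -
  have "((\<lambda>h. (f (x + h) - f x) / h - D) \<longlongrightarrow> 0) (at 0)"
  proof (rule Lim_null_comparison)
    have "\<forall>\<^sub>F h in at 0. h \<noteq> 0 \<and> \<bar>h\<bar> < \<delta>"
      using assms(1) by (auto simp: eventually_at intro!: exI[of _ \<delta>])
    then show "\<forall>\<^sub>F h in at 0. norm ((f (x + h) - f x) / h - D) \<le> C * \<bar>h\<bar>"
    proof eventually_elim
      case (elim h)
      have "norm ((f (x + h) - f x) / h - D) = \<bar>f (x + h) - f x - h * D\<bar> / \<bar>h\<bar>"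
        using elim by (simp add: field_simps flip: abs_divide)
      also have "\<dots> \<le> C * h\<^sup>2 / \<bar>h\<bar>"
        using err[of h] elim by (intro divide_right_mono) auto
      also have "\<dots> = C * \<bar>h\<bar>"
        using elim by (simp add: power2_eq_square field_simps)
      finally show ?case .
    qed
    show "((\<lambda>h. C * \<bar>h\<bar>) \<longlongrightarrow> 0) (at 0)"
      by (auto intro!: tendsto_eq_intros)
  qed
  then show ?thesis
    by (simp add: DERIV_def LIM_zero_iff)
qed

text \<open>The tangent inequality for the exponential is used twice:
  \<open>(1 + u) * exp (- u) \<le> 1\<close> extracts one factor \<open>u\<close>, and estimating
  \<open>1 - exp (- u)\<close> extracts the second. The factor \<open>exp \<bar>u\<bar>\<close> pays
  for negative \<open>u\<close>.\<close>

lemma exp_minus_linear_error: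
  fixes u :: real
  shows "\<bar>exp (- u) - 1 + u\<bar> \<le> u\<^sup>2 * exp \<bar>u\<bar>"
proof -
  have *: "1 - exp (- v) \<le> v" "exp v * exp (- v) = 1" for v :: real
    using exp_ge_add_one_self[of "- v"] by (auto simp flip: exp_add)
  have "(1 + u) * exp (- u) \<le> exp u * exp (- u)"
    by (intro mult_right_mono exp_ge_add_one_self) auto
  then have 1: "exp (- u) - 1 + u \<le> u * (1 - exp (- u))"
    using * by (simp add: algebra_simps)
  have 2: "u * (1 - exp (- u)) \<le> u\<^sup>2 * exp \<bar>u\<bar>"
  proof (cases "u \<ge> 0")
    case True
    then have "u * (1 - exp (- u)) \<le> u * u * 1"
      using *(1)[of u] by (simp add: mult_left_mono)
    also have "\<dots> \<le> u * u * exp \<bar>u\<bar>"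
      using True by (intro mult_left_mono) auto
    finally show ?thesis
      by (simp add: power2_eq_square)
  next
    case False
    have "exp (- u) * (1 - exp u) \<le> exp (- u) * (- u)"
      using *(1)[of "- u"] by (intro mult_left_mono) auto
    then have "exp (- u) - 1 \<le> - u * exp (- u)"
      using *(2)[of u] by (simp add: algebra_simps)
    then have "(- u) * (exp (- u) - 1) \<le> (- u) * (- u * exp (- u))"
      using False by (intro mult_left_mono) auto
    then show ?thesis
      using False by (simp add: power2_eq_square algebra_simps)
  qed
  \<comment> \<open>The quantity inside the absolute value is nonnegative, again by the tangent
    inequality, so the upper bound suffices.\<close>
  show ?thesis
    using 1 2 exp_ge_add_one_self[of "- u"] by linarith
qed

text \<open>Differentiation under the integral sign. For \<open>\<bar>h\<bar> < x / 2\<close> the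
  perturbation costs at most half of the decay, and the square of \<open>h * cosh t\<close> adds two
  powers of \<open>cosh\<close>; this explains the constant
  \<open>cosh_moment (k + 2) (x / 2)\<close>.\<close>

lemma cosh_moment_has_derivative:
  assumes "x > 0"
  shows "(cosh_moment k has_real_derivative - cosh_moment (k + 1) x) (at x)"
proof (rule has_field_derivative_quadratic_error[where \<delta> = "x / 2" and C = "cosh_moment (k + 2) (x / 2)"])
  fix h :: real
  assume h: "\<bar>h\<bar> < x / 2"
  let ?e = "\<lambda>k y t. exp (- y * cosh t) * cosh t powi k"
  have xh: "x + h > 0"
    using h by linarith
  note int = cosh_moment_integrable
  let ?d = "\<lambda>t. ?e k (x + h) t - ?e k x t - (- h) * ?e (k + 1) x t"
  have dint: "set_integrable lborel {0<..} ?d"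
    using assms xh by (intro set_integral_diff set_integrable_mult_right int) auto
  have "cosh_moment k (x + h) - cosh_moment k x - h * - cosh_moment (k + 1) x
      = (LBINT t:{0<..}. ?e k (x + h) t) - (LBINT t:{0<..}. ?e k x t)
         - (LBINT t:{0<..}. (- h) * ?e (k + 1) x t)"
    unfolding cosh_moment_def set_integral_mult_right by simp
  also have "\<dots> = (LBINT t:{0<..}. ?d t)"
    by (simp only: set_integral_diff int[OF assms] int[OF xh] set_integrable_mult_right[OF int[OF assms]])
  finally have "\<bar>cosh_moment k (x + h) - cosh_moment k x - h * - cosh_moment (k + 1) x\<bar>
      = \<bar>LBINT t:{0<..}. ?d t\<bar>"
    by simp
  also have "\<dots> \<le> (LBINT t:{0<..}. \<bar>?d t\<bar>)"
    using set_integral_norm_bound[OF dint] by simp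
  also have "\<dots> \<le> (LBINT t:{0<..}. h\<^sup>2 * ?e (k + 2) (x / 2) t)"
  proof (rule set_integral_mono)
    show "set_integrable lborel {0<..} (\<lambda>t. \<bar>?d t\<bar>)"
      using dint by (rule set_integrable_abs)
    show "set_integrable lborel {0<..} (\<lambda>t. h\<^sup>2 * ?e (k + 2) (x / 2) t)"
      using assms by (intro set_integrable_mult_right int) auto
  next
    fix t :: real
    let ?c = "cosh t"
    have "?d t = ?e k x t * (exp (- (h * ?c)) - 1 + h * ?c)"
      by (simp add: power_int_add exp_add algebra_simps exp_diff exp_minus divide_inverse)
    then have "\<bar>?d t\<bar> = ?e k x t * \<bar>exp (- (h * ?c)) - 1 + h * ?c\<bar>"
      by (simp add: abs_mult)
    also have "\<dots> \<le> ?e k x t * ((h * ?c)\<^sup>2 * exp \<bar>h * ?c\<bar>)"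
      by (intro mult_left_mono exp_minus_linear_error) auto
    also have "\<dots> = h\<^sup>2 * (exp (- x * ?c + \<bar>h\<bar> * ?c) * (?c powi (k + 2)))"
      by (simp add: power_int_add abs_mult exp_add exp_diff power_mult_distrib exp_minus field_simps)
    also have "\<dots> \<le> h\<^sup>2 * ?e (k + 2) (x / 2) t"
    proof (intro mult_left_mono mult_right_mono)
      have "\<bar>h\<bar> * ?c \<le> (x / 2) * ?c"
        using h by (intro mult_right_mono) auto
      then show "exp (- x * ?c + \<bar>h\<bar> * ?c) \<le> exp (- (x / 2) * ?c)"
        unfolding exp_le_cancel_iff by linarith
    qed auto
    finally show "\<bar>?d t\<bar> \<le> h\<^sup>2 * ?e (k + 2) (x / 2) t" .
  qed
  also have "\<dots> = cosh_moment (k + 2) (x / 2) * h\<^sup>2"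
    by (simp add: cosh_moment_def)
  finally show "\<bar>cosh_moment k (x + h) - cosh_moment k x - h * - cosh_moment (k + 1) x\<bar>
      \<le> cosh_moment (k + 2) (x / 2) * h\<^sup>2" .
qed (use assms in auto)

lemma exp_cosh_times_powi_tendsto_0:
  fixes x :: real
  assumes "x > 0"
  shows "((\<lambda>t. exp (- x * cosh t) * cosh t powi k) \<longlongrightarrow> 0) at_top"
proof (rule Lim_null_comparison)
  let ?C = "fact (nat \<bar>k\<bar>) * (2 / x) ^ nat \<bar>k\<bar>"
  show "\<forall>\<^sub>F t in at_top. norm (exp (- x * cosh t) * cosh t powi k) \<le> ?C * exp (- (x / 2 * cosh t))"
    using exp_cosh_times_powi_bound[OF assms] by (intro always_eventually) auto
  have "filterlim (\<lambda>t::real. x / 2 * cosh t) at_top at_top"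
    using assms
    by (intro filterlim_tendsto_pos_mult_at_top[OF tendsto_const _ cosh_real_at_top]) auto
  then have "((\<lambda>t. exp (- (x / 2 * cosh t))) \<longlongrightarrow> 0) at_top"
    by (intro filterlim_compose[OF exp_at_bot]) (simp add: filterlim_uminus_at_bot_at_top filterlim_uminus_at_top)
  then show "((\<lambda>t. ?C * exp (- (x / 2 * cosh t))) \<longlongrightarrow> 0) at_top"
    by (rule tendsto_mult_right_zero)
qed

text \<open>Integrate the derivative of \<open>exp (- x cosh t) sinh t cosh t powi k\<close> over \<open>(0, \<infinity>)\<close>.\<close>

lemma cosh_moment_recurrence:
  assumes "x > 0"
  shows "x * cosh_moment (k + 2) x
    = x * cosh_moment k x + of_int (k + 1) * cosh_moment (k + 1) x - of_int k * cosh_moment (k - 1) x"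
proof -
  let ?e = "\<lambda>k t. exp (- x * cosh t) * cosh t powi k"
  define F where "F = (\<lambda>t. exp (- x * cosh t) * (sinh t * cosh t powi k))"
  \<comment> \<open>This is the derivative of \<open>F\<close> once the square of
    \<open>sinh\<close> is replaced by the square of \<open>cosh\<close> minus 1, so that its
    integral involves moments only.\<close>
  define f where "f = (\<lambda>t. x * ?e k t + of_int (k + 1) * ?e (k + 1) t
                           - of_int k * ?e (k - 1) t - x * ?e (k + 2) t)"
  note int = set_integrable_mult_right[OF cosh_moment_integrable[OF assms]]
  have f_int: "set_integrable lborel {0<..} f"
    unfolding f_def by (intro set_integral_diff set_integral_add int)
  \<comment> \<open>Both boundary values of \<open>F\<close> vanish: at 0 because of the factor
    \<open>sinh t\<close>, at infinity by exponential decay.\<close>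
  have "(LBINT t=0..\<infinity>. f t) = 0 - 0"
  proof (rule interval_integral_FTC_integrable[where F = F])
    fix t :: real
    let ?s = "sinh t" and ?c = "cosh t"
    have s2: "?s * ?s = ?c\<^sup>2 - 1"
      by (simp add: cosh_square_eq flip: power2_eq_square)
    have "(F has_real_derivative
        - (x * ?s) * exp (- x * ?c) * (?s * ?c powi k)
        + exp (- x * ?c) * (?c * ?c powi k + ?s * (of_int k * ?c powi (k - 1) * ?s))) (at t)"
      unfolding F_def by (auto intro!: derivative_eq_intros simp: algebra_simps)
    also have "- (x * ?s) * exp (- x * ?c) * (?s * ?c powi k)
        + exp (- x * ?c) * (?c * ?c powi k + ?s * (of_int k * ?c powi (k - 1) * ?s))
        = exp (- x * ?c) * (?c * ?c powi k + (?s * ?s) * (of_int k * ?c powi (k - 1) - x * ?c powi k))"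
      by (simp add: algebra_simps)
    also have "\<dots> = f t"
      unfolding s2 f_def by (simp add: power_int_add power_int_diff field_simps power2_eq_square)
    finally show "(F has_vector_derivative f t) (at t)"
      by (simp add: has_real_derivative_iff_has_vector_derivative)
    show "isCont f t"
      unfolding f_def by (intro continuous_intros) auto
  next
    have "einterval 0 \<infinity> = {0<..}"
      by (auto simp: einterval_def)
    then show "set_integrable lborel (einterval 0 \<infinity>) f"
      using f_int by simp
  next
    have "isCont F 0"
      unfolding F_def by (intro continuous_intros) auto
    then have "(F \<longlongrightarrow> 0) (at_right 0)"
      by (simp add: isCont_def F_def filterlim_at_split)
    then show "((F \<circ> real_of_ereal) \<longlongrightarrow> 0) (at_right 0)"
      unfolding zero_ereal_def ereal_tendsto_simps .
  next
    have "(F \<longlongrightarrow> 0) at_top"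
    proof (rule Lim_null_comparison[OF always_eventually exp_cosh_times_powi_tendsto_0[OF assms, of "k + 1"]], rule allI)
      fix t :: real
      have "\<bar>sinh t\<bar> \<le> cosh t"
        by (rule abs_le_square_iff[THEN iffD2, of "sinh t" "cosh t", simplified]) (simp add: cosh_square_eq)
      then show "norm (F t) \<le> ?e (k + 1) t"
        unfolding F_def by (simp add: abs_mult power_int_add mult_ac mult_left_mono)
    qed
    then show "((F \<circ> real_of_ereal) \<longlongrightarrow> 0) (at_left \<infinity>)"
      unfolding ereal_tendsto_simps .
  qed auto
  moreover have "(LBINT t=0..\<infinity>. f t) = x * cosh_moment k x + of_int (k + 1) * cosh_moment (k + 1) x
      - of_int k * cosh_moment (k - 1) x - x * cosh_moment (k + 2) x"
    unfolding interval_lebesgue_integral_0_infty f_def cosh_moment_def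
    by (simp only: set_integral_diff set_integral_add int set_integral_mult_right)
  ultimately show ?thesis
    by simp
qed

text \<open>The antiderivative \<open>arctan (sinh t)\<close> rises from 0 to pi/2. The integral is
  the limit of Ki_1 at 0, and the integrand is the majorant for the limits below.\<close>

lemma integral_inverse_cosh:
  "set_integrable lborel {0<..} (\<lambda>t::real. 1 / cosh t)"
  "(LBINT t:{0<..}. 1 / cosh t) = pi / 2"
proof -
  define g where "g = (\<lambda>t::real. arctan (sinh t))"
  have e: "einterval 0 \<infinity> = {0<..}"
    by (auto simp: einterval_def)
  have deriv: "DERIV g t :> 1 / cosh t" for t
  proof -
    have "(cosh t)\<^sup>2 = 1 + (sinh t)\<^sup>2"
      by (simp add: cosh_square_eq)
    then show ?thesis
      unfolding g_def by (auto intro!: derivative_eq_intros simp: power2_eq_square field_simps)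
  qed
  have "isCont g 0"
    unfolding g_def by (intro continuous_intros)
  then have "(g \<longlongrightarrow> 0) (at_right 0)"
    by (simp add: isCont_def g_def filterlim_at_split)
  then have lim0: "((g \<circ> real_of_ereal) \<longlongrightarrow> 0) (at_right 0)"
    unfolding zero_ereal_def ereal_tendsto_simps .
  have "(g \<longlongrightarrow> pi / 2) at_top"
    unfolding g_def by (rule filterlim_compose[OF tendsto_arctan_at_top sinh_real_at_top])
  then have lim1: "((g \<circ> real_of_ereal) \<longlongrightarrow> pi / 2) (at_left \<infinity>)"
    unfolding ereal_tendsto_simps .
  have cont: "isCont (\<lambda>t. 1 / cosh t) t" for t :: real
    by (intro continuous_intros) auto
  show "set_integrable lborel {0<..} (\<lambda>t::real. 1 / cosh t)"
    using interval_integral_FTC_nonneg(1)[OF _ deriv cont _ lim0 lim1] by (simp add: e)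
  show "(LBINT t:{0<..}. 1 / cosh t) = pi / 2"
    using interval_integral_FTC_nonneg(2)[OF _ deriv cont _ lim0 lim1]
    by (simp add: interval_lebesgue_integral_0_infty)
qed

text \<open>Behaviour at the origin: for \<open>k = 0, 1, 2\<close> it says that Ki_1 tends to pi/2
  while x K_0 and x^2 K_1 tend to 0. Sequences are used to match the dominated convergence
  theorem.\<close>

lemma cosh_moment_at_0:
  assumes "\<And>n. X n > 0" "X \<longlonglongrightarrow> 0"
  shows "(\<lambda>n. X n ^ k * cosh_moment (int k - 1) (X n)) \<longlonglongrightarrow> 0 ^ k * (pi / 2)"
proof -
  \<comment> \<open>The weight is distributed so that \<open>X n\<close> occurs only in
    \<open>u = X n * cosh t\<close>; then \<open>u ^ k * exp (- u) \<le> fact k\<close> gives a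
    majorant independent of \<open>n\<close>.\<close>
  define s where "s = (\<lambda>n t. indicator {0<..} t *\<^sub>R ((X n * cosh t) ^ k * exp (- (X n * cosh t)) * (1 / cosh t)))"
  define f where "f = (\<lambda>t::real. indicator {0<..} t *\<^sub>R (0 ^ k * (1 / cosh t)) :: real)"
  have "(\<lambda>n. integral\<^sup>L lborel (s n)) \<longlonglongrightarrow> integral\<^sup>L lborel f"
  proof (rule integral_dominated_convergence)
    show "integrable lborel (\<lambda>t. indicator {0<..} t *\<^sub>R (fact k * (1 / cosh t)) :: real)"
      using set_integrable_mult_right[OF integral_inverse_cosh(1)] unfolding set_integrable_def by blast
    show "f \<in> borel_measurable lborel"
      unfolding f_def by (intro borel_measurable_scaleR borel_measurable_indicator)
        (auto intro!: borel_measurable_continuous_onI continuous_intros)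
    show "s n \<in> borel_measurable lborel" for n
      unfolding s_def by (intro borel_measurable_scaleR borel_measurable_indicator)
        (auto intro!: borel_measurable_continuous_onI continuous_intros)
    show "AE t in lborel. (\<lambda>n. s n t) \<longlonglongrightarrow> f t"
    proof (rule AE_I2)
      fix t :: real
      have "(\<lambda>n. s n t) \<longlonglongrightarrow> indicator {0<..} t *\<^sub>R ((0 * cosh t) ^ k * exp (- (0 * cosh t)) * (1 / cosh t))"
        unfolding s_def using assms(2) by (intro tendsto_intros)
      then show "(\<lambda>n. s n t) \<longlonglongrightarrow> f t"
        by (simp add: f_def)
    qed
    show "AE t in lborel. norm (s n t) \<le> indicator {0<..} t *\<^sub>R (fact k * (1 / cosh t))" for n
    proof (rule AE_I2)
      fix t :: real
      have Xc: "X n * cosh t \<ge> 0"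
        using assms(1)[of n] by simp
      define v where "v = (X n * cosh t) ^ k * exp (- (X n * cosh t)) * (1 / cosh t)"
      have "v \<le> fact k * (1 / cosh t)"
        unfolding v_def by (intro mult_right_mono power_mult_exp_minus_le_fact Xc) auto
      moreover have "v \<ge> 0"
        unfolding v_def using assms(1)[of n] by (intro mult_nonneg_nonneg zero_le_power) auto
      ultimately show "norm (s n t) \<le> indicator {0<..} t *\<^sub>R (fact k * (1 / cosh t))"
        unfolding s_def v_def[symmetric] by (simp add: indicator_def)
    qed
  qed
  moreover have "integral\<^sup>L lborel (s n) = X n ^ k * cosh_moment (int k - 1) (X n)" for n
  proof -
    have "X n ^ k * cosh_moment (int k - 1) (X n)
        = (LBINT t:{0<..}. X n ^ k * (exp (- X n * cosh t) * cosh t powi (int k - 1)))"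
      by (simp add: cosh_moment_def)
    also have "\<dots> = integral\<^sup>L lborel (s n)"
      unfolding set_lebesgue_integral_def s_def
      by (simp add: power_int_diff power_mult_distrib mult_ac)
    finally show ?thesis
      by simp
  qed
  moreover have "integral\<^sup>L lborel f = 0 ^ k * (pi / 2)"
  proof -
    have "(LBINT t:{0<..}. 0 ^ k * (1 / cosh t)) = 0 ^ k * (pi / 2)"
      unfolding set_integral_mult_right integral_inverse_cosh(2) ..
    then show ?thesis
      unfolding f_def set_lebesgue_integral_def .
  qed
  ultimately show ?thesis
    by simp
qed

section \<open>Struve series\<close>

text \<open>The parameter is s = nu + 3/2: \<open>s = 3/2\<close> belongs to L_0 and
  \<open>s = 1/2\<close> to L_{-1}.\<close>

definition struve_coeff :: "real \<Rightarrow> nat \<Rightarrow> real" where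
  "struve_coeff s m = 1 / (Gamma (real m + 3/2) * Gamma (real m + s))"

lemma struve_coeff_Suc:
  assumes "s > 0"
  shows "struve_coeff s (Suc m) = struve_coeff s m / ((real m + 3/2) * (real m + s))"
proof -
  have "Gamma (real m + 3/2 + 1) = (real m + 3/2) * Gamma (real m + 3/2)"
    by (rule Gamma_plus1) (auto elim!: nonpos_Ints_cases)
  moreover have "Gamma (real m + s + 1) = (real m + s) * Gamma (real m + s)"
    using assms by (intro Gamma_plus1) (auto elim!: nonpos_Ints_cases)
  ultimately show ?thesis
    by (simp add: struve_coeff_def add_ac)
qed

text \<open>One step of the Gamma recursion relates the two series; this is the coefficient form of
  L_0' = L_{-1}.\<close>

lemma struve_coeff_half:
  "struve_coeff (1/2) m = (real m + 1/2) * struve_coeff (3/2) m"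
proof -
  have "Gamma (real m + 1/2 + 1) = (real m + 1/2) * Gamma (real m + 1/2)"
    by (rule Gamma_plus1) (auto elim!: nonpos_Ints_cases)
  then have "Gamma (real m + 3/2) = (real m + 1/2) * Gamma (real m + 1/2)"
    by (simp add: add_ac)
  moreover have "Gamma (real m + 1/2) > 0"
    by (rule Gamma_real_pos) auto
  moreover have "1 / (a * b) = c * (1 / (a * a))" if "a = c * b" "b > 0" "c > 0" for a b c :: real
    using that by simp
  ultimately show ?thesis
    unfolding struve_coeff_def by simp
qed

text \<open>The constant term of L_{-1}, from Gamma(1/2) = sqrt pi. It is the source of the 2/pi in
  the derivative of x L_{-1}.\<close>

lemma struve_coeff_half_0: "struve_coeff (1/2) 0 = 2 / pi"
proof -
  have "Gamma (1/2 + 1 :: real) = 1/2 * Gamma (1/2)"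
    by (rule Gamma_plus1) (auto elim!: nonpos_Ints_cases)
  then have "Gamma (3/2 :: real) = sqrt pi / 2"
    by (simp add: Gamma_one_half_real)
  then show ?thesis
    by (simp only: struve_coeff_def of_nat_0 add_0 Gamma_one_half_real) simp
qed

lemma struve_coeff_summable:
  assumes "s > 0"
  shows "summable (\<lambda>m. struve_coeff s m * z ^ m)"
\<comment> \<open>Beyond this index \<open>m\<close> is at least 1 and at least
  \<open>2 * \<bar>z\<bar>\<close>, so the denominator of the ratio is at least \<open>m\<close> and
  the ratio at most 1/2.\<close>
proof (rule summable_ratio_test[where c = "1/2" and N = "nat \<lceil>2 * \<bar>z\<bar>\<rceil> + 1"])
  fix m assume m: "m \<ge> nat \<lceil>2 * \<bar>z\<bar>\<rceil> + 1"
  have m1: "real m \<ge> 2 * \<bar>z\<bar>" "real m \<ge> 1"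
    using m by linarith+
  have "real m * 1 \<le> (real m + 3/2) * (real m + s)"
    using m1 assms by (intro mult_mono) auto
  then have "\<bar>z\<bar> / ((real m + 3/2) * (real m + s)) \<le> 1/2"
    using m1 by (simp add: divide_le_eq)
  then have "norm (struve_coeff s m * z ^ m) * (\<bar>z\<bar> / ((real m + 3/2) * (real m + s)))
      \<le> norm (struve_coeff s m * z ^ m) * (1/2)"
    by (intro mult_left_mono) auto
  moreover have "norm (struve_coeff s (Suc m) * z ^ Suc m)
      = norm (struve_coeff s m * z ^ m) * (\<bar>z\<bar> / ((real m + 3/2) * (real m + s)))"
    using assms by (simp add: struve_coeff_Suc abs_mult power_abs)
  ultimately show "norm (struve_coeff s (Suc m) * z ^ Suc m) \<le> 1/2 * norm (struve_coeff s m * z ^ m)"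
    by linarith
qed simp

text \<open>The Struve series in the variable z = (x/2)^2, without its leading power of x/2: an
  everywhere convergent power series, usable at 0 as well.\<close>

definition struve_series :: "real \<Rightarrow> real \<Rightarrow> real" where
  "struve_series s z = (\<Sum>m. struve_coeff s m * z ^ m)"

lemma struve_series_sums:
  "s > 0 \<Longrightarrow> (\<lambda>m. struve_coeff s m * z ^ m) sums struve_series s z"
  unfolding struve_series_def by (intro summable_sums struve_coeff_summable)

text \<open>The derivative is described through \<open>z * D\<close>, whose series keeps the powers
  of \<open>z\<close> and multiplies each coefficient by its index, so later comparisons are
  coefficientwise.\<close>

lemma struve_series_has_derivative:
  assumes "s > 0"
  obtains D where "(struve_series s has_real_derivative D) (at z)"
    "(\<lambda>m. real m * struve_coeff s m * z ^ m) sums (z * D)"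
proof
  let ?D = "\<Sum>m. diffs (struve_coeff s) m * z ^ m"
  show "(struve_series s has_real_derivative ?D) (at z)"
    unfolding struve_series_def
    using termdiffs_strong_converges_everywhere[OF struve_coeff_summable[OF assms]] .
  have "summable (\<lambda>m. diffs (struve_coeff s) m * z ^ m)"
    by (rule termdiff_converges_all) (rule struve_coeff_summable[OF assms])
  then have "(\<lambda>m. z * (diffs (struve_coeff s) m * z ^ m)) sums (z * ?D)"
    by (intro sums_mult summable_sums)
  then have "(\<lambda>m. real (Suc m) * struve_coeff s (Suc m) * z ^ Suc m) sums (z * ?D)"
    by (simp add: diffs_def mult_ac)
  \<comment> \<open>The shifted series misses only the term of index 0, which is zero.\<close>
  then show "(\<lambda>m. real m * struve_coeff s m * z ^ m) sums (z * ?D)"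
    using sums_Suc_iff[of "\<lambda>m. real m * struve_coeff s m * z ^ m"] by simp
qed

lemma struve_L_eq_series:
  assumes "x > 0"
  shows "struve_L 0 x = x / 2 * struve_series (3/2) ((x / 2)\<^sup>2)"
    and "struve_L (-1) x = struve_series (1/2) ((x / 2)\<^sup>2)"
proof -
  have p0: "(x / 2) powr (2 * real m + 0 + 1) = x / 2 * ((x / 2)\<^sup>2) ^ m" for m
  proof -
    have "2 * real m + 0 + 1 = real (2 * m + 1)"
      by simp
    then show ?thesis
      using assms powr_realpow[of "x / 2" "2 * m + 1"] by (simp only:) (simp add: power_mult)
  qed
  have p1: "(x / 2) powr (2 * real m + - 1 + 1) = ((x / 2)\<^sup>2) ^ m" for m
  proof -
    have "2 * real m + - 1 + 1 = real (2 * m)"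
      by simp
    then show ?thesis
      using assms powr_realpow[of "x / 2" "2 * m"] by (simp only:) (simp add: power_mult)
  qed
  have "(\<lambda>m. x / 2 * (struve_coeff (3/2) m * ((x / 2)\<^sup>2) ^ m)) sums (x / 2 * struve_series (3/2) ((x / 2)\<^sup>2))"
    by (intro sums_mult struve_series_sums) auto
  also have "(\<lambda>m. x / 2 * (struve_coeff (3/2) m * ((x / 2)\<^sup>2) ^ m)) =
      (\<lambda>m. (x / 2) powr (2 * real m + 0 + 1) / (Gamma (real m + 3/2) * Gamma (real m + 0 + 3/2)))"
    unfolding p0 by (simp add: struve_coeff_def)
  finally show "struve_L 0 x = x / 2 * struve_series (3/2) ((x / 2)\<^sup>2)"
    unfolding struve_L_def by (rule sums_unique[symmetric])
  have "real m + - 1 + 3/2 = real m + 1/2" for m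
    by simp
  then show "struve_L (-1) x = struve_series (1/2) ((x / 2)\<^sup>2)"
    unfolding struve_L_def p1 struve_series_def struve_coeff_def by (simp only:) simp
qed

lemma struve_series_isCont: "s > 0 \<Longrightarrow> isCont (struve_series s) z"
  by (rule struve_series_has_derivative[of s z]) (auto intro: DERIV_isCont)

text \<open>This is L_0' = L_{-1}. With z = (x/2)^2 the derivative multiplies the coefficient of
  index m by m + 1/2, as in \<open>struve_coeff_half\<close>.\<close>

lemma struve_series_odd_has_derivative:
  "((\<lambda>x. x / 2 * struve_series (3/2) ((x / 2)\<^sup>2)) has_real_derivative
     struve_series (1/2) ((x / 2)\<^sup>2)) (at x)"
proof -
  define z where "z = (x / 2)\<^sup>2"
  obtain D where D: "(struve_series (3/2) has_real_derivative D) (at z)"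
      and sD: "(\<lambda>m. real m * struve_coeff (3/2) m * z ^ m) sums (z * D)"
    using struve_series_has_derivative[of "3/2" z] by auto
  have "(\<lambda>m. real m * struve_coeff (3/2) m * z ^ m + 1/2 * (struve_coeff (3/2) m * z ^ m))
      sums (z * D + 1/2 * struve_series (3/2) z)"
    by (intro sums_add sD sums_mult struve_series_sums) auto
  also have "(\<lambda>m. real m * struve_coeff (3/2) m * z ^ m + 1/2 * (struve_coeff (3/2) m * z ^ m))
      = (\<lambda>m. struve_coeff (1/2) m * z ^ m)"
    by (simp add: struve_coeff_half algebra_simps fun_eq_iff)
  finally have eq: "struve_series (1/2) z = z * D + 1/2 * struve_series (3/2) z"
    using struve_series_sums[of "1/2" z] sums_unique2 by auto
  have "((\<lambda>x. struve_series (3/2) ((x / 2)\<^sup>2)) has_real_derivative D * (x / 2)) (at x)"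
    by (rule DERIV_chain2[where f = "struve_series (3/2)" and g = "\<lambda>x. (x / 2)\<^sup>2", OF D[unfolded z_def]])
      (auto intro!: derivative_eq_intros simp: power2_eq_square)
  then have "((\<lambda>x. x / 2 * struve_series (3/2) ((x / 2)\<^sup>2)) has_real_derivative
      1 / 2 * struve_series (3/2) z + D * (x / 2) * (x / 2)) (at x)"
    by (auto intro!: derivative_eq_intros simp: z_def)
  also have "1 / 2 * struve_series (3/2) z + D * (x / 2) * (x / 2) = struve_series (1/2) z"
    unfolding eq by (simp add: z_def power2_eq_square)
  finally show ?thesis
    by (simp add: z_def)
qed

text \<open>This is (x L_{-1})' = 2/pi + x L_0. The derivative has coefficients (2m + 1) times those
  of L_{-1}; the term of index 0 is 2/pi, and the shifted rest is the series of x L_0.\<close>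

lemma struve_series_even_has_derivative:
  "((\<lambda>x. x * struve_series (1/2) ((x / 2)\<^sup>2)) has_real_derivative
     2 / pi + x * (x / 2 * struve_series (3/2) ((x / 2)\<^sup>2))) (at x)"
proof -
  define z where "z = (x / 2)\<^sup>2"
  obtain D where D: "(struve_series (1/2) has_real_derivative D) (at z)"
      and sD: "(\<lambda>m. real m * struve_coeff (1/2) m * z ^ m) sums (z * D)"
    using struve_series_has_derivative[of "1/2" z] by auto
  let ?f = "\<lambda>m. (2 * real m + 1) * struve_coeff (1/2) m * z ^ m"
  have "(\<lambda>m. 2 * (real m * struve_coeff (1/2) m * z ^ m) + struve_coeff (1/2) m * z ^ m)
      sums (2 * (z * D) + struve_series (1/2) z)"
    by (intro sums_add sD sums_mult struve_series_sums) auto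
  also have "(\<lambda>m. 2 * (real m * struve_coeff (1/2) m * z ^ m) + struve_coeff (1/2) m * z ^ m) = ?f"
    by (simp add: algebra_simps fun_eq_iff)
  finally have 1: "?f sums (2 * (z * D) + struve_series (1/2) z)" .
  have "(\<lambda>m. 2 * z * (struve_coeff (3/2) m * z ^ m)) sums (2 * z * struve_series (3/2) z)"
    by (intro sums_mult struve_series_sums) auto
  also have "(\<lambda>m. 2 * z * (struve_coeff (3/2) m * z ^ m)) = (\<lambda>m. ?f (Suc m))"
  proof
    fix m
    have "struve_coeff (1/2) (Suc m) = struve_coeff (3/2) m / (real m + 3/2)"
    proof -
      have cancel: "a * c / (b * a) = c / b" if "a > 0" for a b c :: real
        using that by simp
      have "struve_coeff (1/2) (Suc m) = struve_coeff (1/2) m / ((real m + 3/2) * (real m + 1/2))"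
        by (rule struve_coeff_Suc) simp
      also have "\<dots> = struve_coeff (3/2) m / (real m + 3/2)"
        unfolding struve_coeff_half by (rule cancel) simp
      finally show ?thesis .
    qed
    then have "(real m + 3/2) * struve_coeff (1/2) (Suc m) = struve_coeff (3/2) m"
      by simp
    then have "2 * z * (struve_coeff (3/2) m * z ^ m)
        = 2 * z * ((real m + 3/2) * struve_coeff (1/2) (Suc m) * z ^ m)"
      by (simp only:)
    then show "2 * z * (struve_coeff (3/2) m * z ^ m) = ?f (Suc m)"
      by (simp add: algebra_simps)
  qed
  finally have "?f sums (2 * z * struve_series (3/2) z + 2 / pi)"
    using sums_Suc_iff[of ?f] by (simp add: struve_coeff_half_0)
  with 1 have eq: "2 * (z * D) + struve_series (1/2) z = 2 * z * struve_series (3/2) z + 2 / pi"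
    by (rule sums_unique2)
  have "((\<lambda>x. struve_series (1/2) ((x / 2)\<^sup>2)) has_real_derivative D * (x / 2)) (at x)"
    by (rule DERIV_chain2[where f = "struve_series (1/2)" and g = "\<lambda>x. (x / 2)\<^sup>2", OF D[unfolded z_def]])
      (auto intro!: derivative_eq_intros simp: power2_eq_square)
  then have "((\<lambda>x. x * struve_series (1/2) ((x / 2)\<^sup>2)) has_real_derivative
      struve_series (1/2) z + D * (x / 2) * x) (at x)"
    by (auto intro!: derivative_eq_intros simp: z_def)
  also have "struve_series (1/2) z + D * (x / 2) * x = 2 * (z * D) + struve_series (1/2) z"
    by (simp add: z_def power2_eq_square)
  also have "\<dots> = 2 / pi + x * (x / 2 * struve_series (3/2) z)"
    unfolding eq by (simp add: z_def power2_eq_square)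
  finally show ?thesis
    by (simp add: z_def)
qed

section \<open>The closed form of the first Bickley-Naylor function\<close>

lemma bickley_naylor_1:
  assumes "x > 0"
  shows "bickley_naylor 1 x = pi / 2 - pi / 2 * (x * A_fun x)"
proof -
  define P where "P = (\<lambda>x. struve_series (3/2) ((x / 2)\<^sup>2))"
  define Q where "Q = (\<lambda>x. struve_series (1/2) ((x / 2)\<^sup>2))"
  \<comment> \<open>\<open>B\<close> is x A, grouped so that each factor has a simple derivative: (x
    K_1)' = - x K_0, and the two Struve factors are those differentiated above.\<close>
  define B where "B = (\<lambda>x. cosh_moment 0 x * (x * Q x) + (x * cosh_moment 1 x) * (x / 2 * P x))"
  define G where "G = (\<lambda>x. cosh_moment (-1) x + pi / 2 * B x)"
  have B: "B y = y * A_fun y" if "y > 0" for y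
    using that by (simp add: B_def A_fun_def struve_L_eq_series P_def Q_def bessel_K_eq_cosh_moment algebra_simps)
  have dG: "(G has_real_derivative 0) (at y)" if y: "y > 0" for y
  proof -
    have "((\<lambda>y. y * cosh_moment 1 y) has_real_derivative
        cosh_moment 1 y - y * cosh_moment 2 y) (at y)"
      using cosh_moment_has_derivative[OF y, of 1] by (auto intro!: derivative_eq_intros)
    also have "cosh_moment 1 y - y * cosh_moment 2 y = - (y * cosh_moment 0 y)"
      using cosh_moment_recurrence[OF y, of 0] by simp
    finally have d1: "((\<lambda>y. y * cosh_moment 1 y) has_real_derivative
        - (y * cosh_moment 0 y)) (at y)" .
    have dP: "((\<lambda>x. x / 2 * P x) has_real_derivative Q y) (at y)"
      and dQ: "((\<lambda>x. x * Q x) has_real_derivative 2 / pi + y * (y / 2 * P y)) (at y)"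
      unfolding P_def Q_def
      by (rule struve_series_odd_has_derivative struve_series_even_has_derivative)+
    have d0: "(cosh_moment 0 has_real_derivative - cosh_moment 1 y) (at y)"
      using cosh_moment_has_derivative[OF y, of 0] by simp
    have "(B has_real_derivative
        - cosh_moment 1 y * (y * Q y) + cosh_moment 0 y * (2 / pi + y * (y / 2 * P y))
        + (- (y * cosh_moment 0 y) * (y / 2 * P y) + (y * cosh_moment 1 y) * Q y)) (at y)"
      unfolding B_def
      by (rule DERIV_cong[OF DERIV_add[OF DERIV_mult[OF d0 dQ] DERIV_mult[OF d1 dP]]])
        (simp add: algebra_simps)
    \<comment> \<open>All products of a Bessel and a Struve function cancel; only the inhomogeneous
      term 2/pi times K_0 survives.\<close>
    also have "- cosh_moment 1 y * (y * Q y) + cosh_moment 0 y * (2 / pi + y * (y / 2 * P y))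
        + (- (y * cosh_moment 0 y) * (y / 2 * P y) + (y * cosh_moment 1 y) * Q y)
        = 2 / pi * cosh_moment 0 y"
      by (simp add: algebra_simps)
    finally show ?thesis
      unfolding G_def using cosh_moment_has_derivative[OF y, of "-1"]
      by (auto intro!: derivative_eq_intros)
  qed
  have const: "G y = G x" if "y > 0" for y
  proof (rule has_field_derivative_zero_constant[of "{0<..}" G, THEN exE])
    show "\<And>y. y \<in> {0<..} \<Longrightarrow> (G has_field_derivative 0) (at y within {0<..})"
      using dG by (auto intro: has_field_derivative_at_within)
  qed (use that assms in auto)
  define X where "X = (\<lambda>n. inverse (real (Suc n)))"
  have X: "X n > 0" "X \<longlonglongrightarrow> 0" for n
    unfolding X_def by (auto intro: LIMSEQ_inverse_real_of_nat simp del: of_nat_Suc)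
  have "isCont P 0" "isCont Q 0"
    unfolding P_def Q_def
    by (intro continuous_intros isCont_o2[OF _ struve_series_isCont]; simp)+
  then have PQ: "(\<lambda>n. P (X n)) \<longlonglongrightarrow> P 0" "(\<lambda>n. Q (X n)) \<longlonglongrightarrow> Q 0"
    using X(2) by (auto intro: isCont_tendsto_compose)
  \<comment> \<open>\<open>G\<close> is written with the weights of \<open>cosh_moment_at_0\<close>
    for \<open>k = 0, 1, 2\<close>. As \<open>P\<close> and \<open>Q\<close> stay bounded near 0,
    only the limit pi/2 of Ki_1 remains.\<close>
  have "(\<lambda>n. X n ^ 0 * cosh_moment (int 0 - 1) (X n)
        + pi / 2 * (X n ^ 1 * cosh_moment (int 1 - 1) (X n) * Q (X n)
                    + X n ^ 2 * cosh_moment (int 2 - 1) (X n) * (P (X n) / 2)))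
      \<longlonglongrightarrow> 0 ^ 0 * (pi / 2) + pi / 2 * (0 ^ 1 * (pi / 2) * Q 0 + 0 ^ 2 * (pi / 2) * (P 0 / 2))"
    by (intro tendsto_intros cosh_moment_at_0 X PQ) auto
  then have "(\<lambda>n. G (X n)) \<longlonglongrightarrow> pi / 2"
    by (simp add: G_def B_def power2_eq_square mult_ac)
  moreover have "(\<lambda>n. G (X n)) = (\<lambda>n. G x)"
    using const X(1) by auto
  ultimately have "G x = pi / 2"
    by (simp add: LIMSEQ_const_iff)
  then show ?thesis
    using assms by (simp add: G_def B bickley_naylor_eq_cosh_moment)
qed

section \<open>Membership in the module\<close>

text \<open>The moment recurrence at \<open>k = - n - 2\<close>, solved for the highest order. The
  divisor is a nonzero constant, so the coefficients are polynomials in \<open>x\<close>.\<close>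

lemma bickley_naylor_recurrence:
  assumes "x > 0"
  shows "bickley_naylor (n + 3) x = x / (real n + 2) * bickley_naylor n x
    - x / (real n + 2) * bickley_naylor (n + 2) x + (real n + 1) / (real n + 2) * bickley_naylor (n + 1) x"
proof -
  have "- int n - 2 + 2 = - int n" "- int n - 2 + 1 = - int n - 1" "- int n - 2 - 1 = - int n - 3"
    by auto
  then have "(real n + 2) * bickley_naylor (n + 3) x = x * bickley_naylor n x
      - x * bickley_naylor (n + 2) x + (real n + 1) * bickley_naylor (n + 1) x"
    using cosh_moment_recurrence[OF assms, of "- int n - 2"] assms
    by (simp add: bickley_naylor_eq_cosh_moment algebra_simps)
  then have "bickley_naylor (n + 3) x = (x * bickley_naylor n x
      - x * bickley_naylor (n + 2) x + (real n + 1) * bickley_naylor (n + 1) x) / (real n + 2)"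
    by (intro eq_divide_imp) (auto simp: mult.commute)
  then show ?thesis
    by (simp add: add_divide_distrib diff_divide_distrib distrib_right)
qed

text \<open>At \<open>k = - 1\<close> the factor \<open>k + 1\<close> removes the Ki_0 term, and the
  recurrence reaches back to Ki_{-1} = K_1.\<close>

lemma bickley_naylor_2:
  assumes "x > 0"
  shows "bickley_naylor 2 x = x * bessel_K 1 x - x * bickley_naylor 1 x"
  using cosh_moment_recurrence[OF assms, of "-1"] assms
  by (simp add: bickley_naylor_eq_cosh_moment bessel_K_eq_cosh_moment)

text \<open>Strong induction with orders 0, 1 and 2 treated separately, since the recurrence reaches
  three orders back.\<close>

lemma bickley_naylor_in_M_module: "on_pos (bickley_naylor n) \<in> M_module"
proof (induction n rule: less_induct)
  case (less n)
  note in_M = poly_fun.span_add poly_fun.span_diff poly_fun.span_scale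
  \<comment> \<open>Fixing the generating set and folding the definition turns the span rules into
    closure rules for \<open>M_module\<close>.\<close>
  note in_M = in_M[where S = "on_pos ` {\<lambda>_. 1, bessel_K 0, bessel_K 1, A_fun}", folded M_module_def]
  have base: "on_pos f \<in> M_module" if "f \<in> {\<lambda>_. 1, bessel_K 0, bessel_K 1, A_fun}" for f
    unfolding M_module_def using that by (intro poly_fun.span_base imageI)
  consider "n = 0" | "n = 1" | "n = 2" | m where "n = m + 3"
    by (metis One_nat_def add.commute add_2_eq_Suc' le_Suc_ex less_2_cases_iff linorder_not_less
        nat_less_le numeral_3_eq_3 Suc_leI numeral_2_eq_2)
  then show ?case
  proof cases
    case 1
    then have "on_pos (bickley_naylor n) = on_pos (bessel_K 0)"
      by (auto simp: on_pos_def bickley_naylor_eq_cosh_moment bessel_K_eq_cosh_moment)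
    then show ?thesis
      using base by simp
  next
    case 2
    then have eq: "on_pos (bickley_naylor n)
        = poly_scale [:pi/2:] (on_pos (\<lambda>_. 1)) - poly_scale [:0, pi/2:] (on_pos A_fun)"
      using bickley_naylor_1 by (auto simp: on_pos_def poly_scale_def fun_eq_iff)
    show ?thesis
      unfolding eq by (intro in_M base) auto
  next
    case 3
    then have eq: "on_pos (bickley_naylor n)
        = poly_scale [:0, 1:] (on_pos (bessel_K 1)) - poly_scale [:0, 1:] (on_pos (bickley_naylor 1))"
      using bickley_naylor_2 by (auto simp: on_pos_def poly_scale_def fun_eq_iff)
    show ?thesis
      unfolding eq using 3 by (intro in_M base less) auto
  next
    case 4
    then have eq: "on_pos (bickley_naylor n)
        = poly_scale [:0, 1 / (real m + 2):] (on_pos (bickley_naylor m))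
          - poly_scale [:0, 1 / (real m + 2):] (on_pos (bickley_naylor (m + 2)))
          + poly_scale [:(real m + 1) / (real m + 2):] (on_pos (bickley_naylor (m + 1)))"
      using bickley_naylor_recurrence[of _ m] by (auto simp: on_pos_def poly_scale_def fun_eq_iff)
    show ?thesis
      unfolding eq using 4 by (intro in_M less) auto
  qed
qed

text \<open>\<open>span_breakdown_eq\<close> splits off one generator at a time; after four steps
  the remainder lies in the span of the empty set and hence is zero.\<close>

lemma M_module_combination:
  assumes "on_pos f \<in> M_module"
  shows "\<exists>a b c d. \<forall>x>0. f x = poly a x + poly b x * bessel_K 0 x
    + poly c x * bessel_K 1 x + poly d x * A_fun x"
proof -
  obtain a b c d where "on_pos f - poly_scale a (on_pos (\<lambda>_. 1)) - poly_scale b (on_pos (bessel_K 0))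
      - poly_scale c (on_pos (bessel_K 1)) - poly_scale d (on_pos A_fun) = 0"
    using assms unfolding M_module_def by (auto simp: poly_fun.span_breakdown_eq)
  then have "f x = poly a x + poly b x * bessel_K 0 x
      + poly c x * bessel_K 1 x + poly d x * A_fun x" if "x > 0" for x
    using that by (drule_tac fun_cong[of _ _ x]) (simp add: on_pos_def poly_scale_def)
  then show ?thesis
    by blast
qed

theorem theorem2:
  shows "range (\<lambda>n. on_pos (bickley_naylor n)) \<subseteq> M_module \<and>
    (\<forall>n. \<exists>a b c d :: real poly. \<forall>x>0.
       bickley_naylor n x = poly a x + poly b x * bessel_K 0 x
         + poly c x * bessel_K 1 x + poly d x * A_fun x)"
  using bickley_naylor_in_M_module M_module_combination by blast

end
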